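(* The source-free partition function of zero-dimensional QED, $Z_0^{\mathrm{QED}}(\hbar)=\sum_{n\ge0}\hbar^n(2n-1)!!\,[x^{2n}]\frac{1}{\sqrt{1-x^2}}$, satisfies $$Z_0^{\mathrm{QED}}(\hbar)=\mathcal{F}\left[-\frac{\sin^2(x)}{2}\right](\hbar),$$ and it has a factorial asymptotic expansion with $A=\frac12$, $\beta=0$: for every $R\ge0$, as $n\to\infty$, $$[\hbar^n]Z_0^{\mathrm{QED}}(\hbar)=\sum_{k=0}^{R-1}c_k\left(\tfrac12\right)^{-n+k}\Gamma(n-k)+\mathcal{O}\left(\left(\tfrac12\right)^{-n}\Gamma(n-R)\right),\qquad \sum_{k\ge0}c_k\hbar^k=\frac{1}{\pi}\,\mathcal{F}\left[-\frac{\sin^2(x)}{2}\right](-\hbar).$$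
   Context: For $\mathcal{S}(x)=-\frac{x^2}{2a}+V(x)$ with $a>0$ and $V\in x^3\mathbb{R}[[x]]$, the formal integral is the formal power series $$\mathcal{F}[\mathcal{S}(x)](\hbar)=\sqrt{a}\sum_{n=0}^\infty (a\hbar)^n(2n-1)!!\,[x^{2n}]e^{\frac1\hbar V(x)},\qquad(-1)!!=1.$$ $\mathcal{F}[\cdot](-\hbar)$ means substituting $-\hbar$ for $\hbar$ in this series. *)

theory Defs
  imports
    "HOL-Analysis.Gamma_Function"
    "HOL-Computational_Algebra.Computational_Algebra"
    "HOL-Library.Landau_Symbols"
begin

text \<open>\<open>odd_dfact n\<close> is the double factorial \<open>(2n - 1)!!\<close>, with \<open>(-1)!! = 1\<close>.\<close>

definition odd_dfact :: "nat \<Rightarrow> nat" where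
  "odd_dfact n = (\<Prod>i<n. 2 * i + 1)"

text \<open>
  \<open>exp_over_hbar V\<close> is \<open>e\<^bsup>V(x)/\<hbar>\<^esup>\<close>, a power series in \<open>x\<close> whose coefficients are formal Laurent
  series in \<open>\<hbar>\<close>. It is a legitimate composition only when \<open>V\<close> has no constant term.
\<close>

definition exp_over_hbar :: "real fps \<Rightarrow> real fls fps" where
  "exp_over_hbar V = fps_exp 1 oo Abs_fps (\<lambda>i. fls_X_inv * fls_const (fps_nth V i))"

definition formal_integral_term :: "real \<Rightarrow> real fps \<Rightarrow> nat \<Rightarrow> real fls" where
  "formal_integral_term a V n =
     (fls_const a * fls_X) ^ n * of_nat (odd_dfact n) * fps_nth (exp_over_hbar V) (2 * n)"

text \<open>
  The formal integral of \<open>S(x) = -x\<^sup>2/(2a) + V(x)\<close>; the number \<open>a\<close> is read off from the quadratic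
  coefficient of \<open>S\<close>. The definition is meaningful only for \<open>a > 0\<close> and \<open>V \<in> x\<^sup>3\<real>[[x]]\<close>. In that
  case every summand is a power series in \<open>\<hbar>\<close> (lemma \<open>formal_integral_term_power_series\<close>), so
  that taking the regular part merely changes its type, and the infinite sum converges in the
  usual topology of formal power series (lemma \<open>formal_integral_summable\<close>).
\<close>

definition formal_integral :: "real fps \<Rightarrow> real fps" where
  "formal_integral S =
     (let a = - 1 / (2 * fps_nth S 2);
          V = S + fps_const (1 / (2 * a)) * fps_X ^ 2
      in fps_const (sqrt a) * (\<Sum>n. fls_regpart (formal_integral_term a V n)))"

lemma formal_integral_eq:
  assumes "a > 0" and "fps_X ^ 3 dvd V"
  shows "formal_integral (- (fps_const (1 / (2 * a)) * fps_X ^ 2) + V) =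
           fps_const (sqrt a) * (\<Sum>n. fls_regpart (formal_integral_term a V n))"
proof -
  have "fps_nth V 2 = 0"
    using assms(2) by (auto simp: dvd_def fps_X_power_mult_nth)
  then show ?thesis
    using assms(1) by (simp add: formal_integral_def Let_def)
qed

lemma fls_nth_formal_integral_term:
  "fls_nth (formal_integral_term a V n) m =
     a ^ n * real (odd_dfact n) *
       (\<Sum>k\<le>2 * n. if int n - int k = m then fps_nth (V ^ k) (2 * n) / fact k else 0)"
proof -
  define U where "U = Abs_fps (\<lambda>i. fls_const (fps_nth V i))"
  have U: "fps_nth (U ^ k) j = fls_const (fps_nth (V ^ k) j)" for k j
  proof (induction k arbitrary: j)
    case (Suc k)
    have hom: "(\<Sum>i\<in>A. fls_const (f i)) = fls_const (\<Sum>i\<in>A. f i)"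
      for A :: "nat set" and f :: "nat \<Rightarrow> real"
      by (induction A rule: infinite_finite_induct) (auto simp: fls_plus_const)
    show ?case
      by (simp add: fps_mult_nth Suc.IH hom) (simp add: U_def hom)
  qed auto
  have W: "Abs_fps (\<lambda>i. fls_X_inv * fls_const (fps_nth V i)) = fps_const fls_X_inv * U"
    by (rule fps_ext) (simp add: U_def)
  have c: "1 / (of_nat (fact k) :: real fls) = fls_const (1 / fact k)" for k
    by (simp add: fls_of_nat fls_inverse_const divide_inverse del: of_nat_fact) (simp only: of_nat_fact)
  have "fps_nth (exp_over_hbar V) j =
          (\<Sum>k\<le>j. fls_const (fps_nth (V ^ k) j / fact k) * fls_X_inv ^ k)" for j
    unfolding exp_over_hbar_def W fps_compose_nth atLeast0AtMost
    by (intro sum.cong refl)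
      (simp add: power_mult_distrib fps_const_power U c mult_ac del: of_nat_fact)
  then have e: "formal_integral_term a V n =
      fls_const (a ^ n * real (odd_dfact n)) *
        (\<Sum>k\<le>2 * n. fls_const (fps_nth (V ^ k) (2 * n) / fact k) * (fls_X ^ n * fls_X_inv ^ k))"
    by (simp add: formal_integral_term_def power_mult_distrib fls_const_power fls_of_nat
        sum_distrib_left mult_ac flip: fls_const_mult_const)
  have "(fls_X ^ n * fls_X_inv ^ k :: real fls) = fls_X_intpow (int n - int k)" for k
    by (simp add: fls_X_power_conv_shift_1 fls_X_inv_power_conv_shift_1 fls_shifted_times_simps)
  moreover have "m + (int k - int n) = 0 \<longleftrightarrow> int n - int k = m" for k
    by linarith
  ultimately show ?thesis
    unfolding e by (simp add: fls_nth_sum if_distrib cong: if_cong)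
qed

lemma fls_nth_formal_integral_term_eq_0:
  assumes "fps_X ^ 3 dvd V" and "3 * m < int n"
  shows "fls_nth (formal_integral_term a V n) m = 0"
proof -
  obtain W where W: "V = fps_X ^ 3 * W"
    using assms(1) by (auto simp: dvd_def)
  have "fps_nth (V ^ k) (2 * n) = 0" if "int n - int k = m" for k
  proof -
    have "2 * n < 3 * k"
      using that assms(2) by linarith
    then show ?thesis
      by (simp add: W power_mult_distrib flip: power_mult) (simp add: fps_X_power_mult_nth)
  qed
  then show ?thesis
    by (simp add: fls_nth_formal_integral_term sum.neutral)
qed

lemma formal_integral_term_power_series:
  assumes "fps_X ^ 3 dvd V"
  shows "fps_to_fls (fls_regpart (formal_integral_term a V n)) = formal_integral_term a V n"
  by (rule fls_eqI) (auto simp: fls_nth_formal_integral_term_eq_0[OF assms])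

lemma formal_integral_summable:
  assumes "fps_X ^ 3 dvd V"
  shows "(\<lambda>n. fls_regpart (formal_integral_term a V n)) sums
           Abs_fps (\<lambda>m. \<Sum>n\<le>3 * m. fls_nth (formal_integral_term a V n) (int m))"
  unfolding sums_def tendsto_fps_iff
proof
  fix m
  have "fps_nth (\<Sum>n<N. fls_regpart (formal_integral_term a V n)) m =
          (\<Sum>n\<le>3 * m. fls_nth (formal_integral_term a V n) (int m))" if "N > 3 * m" for N
    unfolding fps_sum_nth fls_regpart_nth
    by (rule sum.mono_neutral_right)
      (use that in \<open>auto intro!: fls_nth_formal_integral_term_eq_0[OF assms]\<close>)
  then show "\<forall>\<^sub>F N in sequentially.
      fps_nth (\<Sum>n<N. fls_regpart (formal_integral_term a V n)) m =
        fps_nth (Abs_fps (\<lambda>m. \<Sum>n\<le>3 * m. fls_nth (formal_integral_term a V n) (int m))) m"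
    unfolding fps_nth_Abs_fps
    by (rule eventually_mono[OF eventually_gt_at_top])
qed

text \<open>
  \<open>Z0_QED\<close>, as a power series in \<open>\<hbar>\<close>; \<open>fps_radical root 2 (1 - fps_X ^ 2)\<close> is the power series
  \<open>\<surd>(1 - x\<^sup>2)\<close> with constant term \<open>1\<close>.
\<close>

definition Z0_QED :: "real fps" where
  "Z0_QED = Abs_fps (\<lambda>n. real (odd_dfact n) *
     fps_nth (inverse (fps_radical root 2 (1 - fps_X ^ 2))) (2 * n))"

definition sin_action :: "real fps" where
  "sin_action = - (fps_const (1 / 2) * fps_sin 1 ^ 2)"

text \<open>The action \<open>-sin\<^sup>2(x)/2\<close> is admissible, with \<open>a = 1\<close>.\<close>

lemma sin_action_admissible:
  obtains V where "sin_action = - (fps_const (1 / (2 * 1)) * fps_X ^ 2) + V" and "fps_X ^ 3 dvd V"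
proof
  define V where "V = sin_action + fps_const (1 / (2 * 1)) * fps_X ^ 2"
  show "sin_action = - (fps_const (1 / (2 * 1)) * fps_X ^ 2) + V"
    by (simp add: V_def)
  have z: "fps_nth V i = 0" if "i < 3" for i
  proof -
    have "i = 0 \<or> i = 1 \<or> i = 2"
      using that by linarith
    then show ?thesis
      by (auto simp: V_def sin_action_def power2_eq_square fps_mult_nth fps_sin_def
          numeral_2_eq_2 fps_X_def)
  qed
  have "V = fps_X ^ 3 * fps_shift 3 V"
    by (rule fps_ext) (auto simp: fps_X_power_mult_nth z)
  then show "fps_X ^ 3 dvd V"
    by (rule dvdI)
qed

end

theory Submission
  imports Defs "HOL-Real_Asymp.Real_Asymp"
begin

text \<open>
  Put \<open>sin x = x H(x)\<close> and \<open>V = x\<^sup>2 (1 - H\<^sup>2) / 2\<close>. Since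
  \<open>(2m + 2k - 1)!! = (2m - 1)!! 2\<^sup>k (m + 1/2)\<^sub>k\<close>, the binomial series collapses the coefficient
  of \<open>\<hbar>\<^sup>m\<close> in the formal integral to \<open>(2m - 1)!! [x\<^bsup>2m\<^esup>] H\<^bsup>-(2m+1)\<^esup>\<close>. The last factor is the
  residue of \<open>(sin x)\<^bsup>-(2m+1)\<^esup>\<close>; since the derivative of \<open>cos x (sin x)\<^bsup>-2m\<^esup>\<close> has no residue,
  it equals \<open>(1/2)\<^sub>m / m!\<close>, which is also the coefficient of \<open>x\<^bsup>2m\<^esup>\<close> in \<open>(1 - x\<^sup>2)\<^bsup>-1/2\<^esup>\<close>.

  For the asymptotics, \<open>g n = \<pi> (1/2)\<^sub>n\<^sup>2 / n!\<close> satisfies \<open>(n + 1) g (n + 1) = (n + 1/2)\<^sup>2 g n\<close>. The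
  partial sums of the expansion satisfy the same recurrence up to a single telescoped term, so
  their ratio to \<open>g\<close>, which tends to \<open>1\<close> by Wallis' product, has increments of order
  \<open>n\<^bsup>-R-1\<^esup>\<close> and hence differs from \<open>1\<close> by \<open>O(n\<^bsup>-R\<^esup>)\<close>.
\<close>

section \<open>Double factorials, square roots of power series, and the coefficients of
  \<open>Z0_QED\<close>\<close>

lemma odd_dfact_add:
  "real (odd_dfact (m + k)) = real (odd_dfact m) * 2 ^ k * pochhammer (real m + 1 / 2) k"
  by (induction k) (simp_all add: odd_dfact_def pochhammer_Suc field_simps)

lemma odd_dfact_pochhammer: "real (odd_dfact n) = 2 ^ n * pochhammer (1 / 2) n"
  using odd_dfact_add[of 0 n] by (simp add: odd_dfact_def)

text \<open>Power series over an integral domain form an integral domain, so the squares leave only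
  the sign open; the nonzero constant term decides it.\<close>

lemma fps_eq_of_square_eq:
  fixes f g :: "'a::{idom, ring_char_0} fps"
  assumes "f ^ 2 = g ^ 2" and "fps_nth f 0 = fps_nth g 0" and "fps_nth g 0 \<noteq> 0"
  shows "f = g"
proof -
  have "f \<noteq> - g"
    using assms(2,3) by (metis eq_neg_iff_add_eq_0 fps_neg_nth mult_2 mult_eq_0_iff zero_neq_numeral)
  then show ?thesis
    using assms(1) by (simp add: power2_eq_iff)
qed

text \<open>Squaring turns the half-integral exponent into \<open>- p\<close>, where the binomial
  series is an inverse power of \<open>1 + fps_X\<close>; both sides have constant term 1, so they
  are the same square root. The case \<open>p = 1\<close> yields \<open>Z0_QED\<close>, and
  \<open>p = 2 * m + 1\<close> the formal integral.\<close>

lemma fps_binomial_half_compose: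
  fixes u h :: "'a::field_char_0 fps"
  assumes "1 + u = h ^ 2" and "fps_nth h 0 = 1"
  shows "fps_binomial (- (of_nat p / 2)) oo u = inverse h ^ p"
proof (rule fps_eq_of_square_eq)
  have u0: "fps_nth u 0 = 0"
    using arg_cong[OF assms(1), of "\<lambda>f. fps_nth f 0"] assms(2) by (simp add: power2_eq_square)
  have "(fps_binomial (- (of_nat p / 2)) oo u) ^ 2 = fps_binomial (- of_nat p) oo u"
    by (simp add: fps_compose_power[OF u0] fps_binomial_power)
  also have "\<dots> = inverse ((1 + fps_X) ^ p) oo u"
    by (simp add: fps_binomial_minus_of_nat)
  also have "\<dots> = inverse ((1 + u) ^ p)"
    using u0 by (simp add: fps_inverse_compose fps_compose_add_distrib flip: fps_compose_power)
  also have "\<dots> = (inverse h ^ p) ^ 2"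
    by (simp add: assms(1) fps_inverse_power mult.commute flip: power_mult)
  finally show "(fps_binomial (- (of_nat p / 2)) oo u) ^ 2 = (inverse h ^ p) ^ 2" .
qed (use assms(2) in \<open>simp_all add: fps_power_zeroth\<close>)

text \<open>The closed form through which \<open>Z0_QED\<close> and the formal integral are
  compared.\<close>

lemma fps_nth_Z0_QED: "fps_nth Z0_QED n = 2 ^ n * pochhammer (1 / 2) n ^ 2 / fact n"
proof -
  define h :: "real fps" where "h = fps_radical root 2 (1 - (fps_X ^ 2))"
  have h: "h ^ 2 = 1 - (fps_X ^ 2)"
    using power_radical[of "1 - (fps_X ^ 2) :: real fps" root 1]
    by (simp add: h_def numeral_2_eq_2)
  have "inverse h = fps_binomial (- (1 / 2)) oo (- (fps_X ^ 2))"
    using fps_binomial_half_compose[of "- (fps_X ^ 2)" h 1] h by (simp add: h_def)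
  moreover have "fps_nth (fps_binomial (- (1 / 2) :: real) oo (- (fps_X ^ 2))) (2 * n) =
      pochhammer (1 / 2) n / fact n"
  proof -
    have *: "fps_nth ((- (fps_X ^ 2)) ^ i :: real fps) (2 * n) = (if i = n then (-1) ^ n else 0)" for i
    proof -
      have "(- (fps_X ^ 2)) ^ i = fps_const ((-1) ^ i) * (fps_X :: real fps) ^ (2 * i)"
        by (simp add: power_minus[of "fps_X ^ 2"] flip: fps_const_power power_mult)
      then show ?thesis
        by (simp only: fps_mult_left_const_nth fps_X_power_nth) simp
    qed
    have "fps_nth (fps_binomial (- (1 / 2) :: real) oo (- (fps_X ^ 2))) (2 * n) =
        (\<Sum>i=0..2 * n. if i = n then pochhammer (1 / 2) n / fact n else 0)"
      unfolding fps_compose_nth *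
      by (rule sum.cong) (auto simp: gbinomial_pochhammer mult_ac simp flip: power_add mult_2)
    then show ?thesis
      by simp
  qed
  ultimately show ?thesis
    unfolding Z0_QED_def h_def[symmetric]
    by (simp add: odd_dfact_pochhammer power2_eq_square[of "pochhammer _ _"])
qed

section \<open>The residue of odd inverse powers of the sine\<close>

lemma residue_inverse_sin_power:
  fixes H :: "real fps"
  assumes H: "fps_X * H = fps_sin 1"
  shows "fps_nth (inverse H ^ (2 * m + 1)) (2 * m) = pochhammer (1 / 2) m / fact m"
proof -
  have H0: "fps_nth H 0 = 1"
    using arg_cong[OF H, of "\<lambda>f. fps_nth f 1"] by simp
  show ?thesis
  proof (induction m)
    case 0
    show ?case
      using H0 by simp
  next
    case (Suc m)
    define P where "P = inverse H"
    define C :: "real fps" where "C = fps_cos 1"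
    define N where "N = 2 * m + 2"
    have HP: "H * P = 1"
      using H0 by (simp add: P_def inverse_mult_eq_1')
    have C2: "C ^ 2 = 1 - (fps_X ^ 2) * H ^ 2"
      using fps_sin_cos_sum_of_squares[of "1::real"]
      by (simp add: C_def eq_diff_eq flip: H power_mult_distrib)
    have dH: "fps_X * fps_deriv H = C - H"
      using arg_cong[OF H, of fps_deriv] by (simp add: C_def fps_sin_deriv algebra_simps)
    have dP: "fps_X * fps_deriv P = P - C * P ^ 2"
    proof -
      have "fps_X * fps_deriv P = - (fps_X * fps_deriv H) * P ^ 2"
        using H0 by (simp add: P_def fps_inverse_deriv fps_inverse_power)
      also have "\<dots> = (H * P) * P - C * P ^ 2"
        unfolding dH by (simp add: algebra_simps power2_eq_square)
      finally show ?thesis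
        by (simp add: HP)
    qed
    have dC: "fps_X * fps_deriv C = - (fps_X ^ 2 * H)"
      by (simp add: C_def fps_cos_deriv power2_eq_square mult.assoc flip: H fps_const_neg)
    \<comment> \<open>With \<open>P\<close> = x / sin x, \<open>f\<close> is x^N times cos x (sin
      x)^(-N), so x f' - N f is x^(N+1) times the derivative of that Laurent series. This keeps the
      residue argument inside power series.\<close>
    define f where "f = C * P ^ N"
    have "fps_X * fps_deriv f =
        fps_X * fps_deriv C * P ^ N + of_nat N * C * P ^ (N - 1) * (fps_X * fps_deriv P)"
      by (simp add: f_def fps_deriv_power fps_of_nat algebra_simps)
    also have "\<dots> = - (fps_X ^ 2 * (H * P) * P ^ (N - 1)) + of_nat N * f
        - of_nat N * (C ^ 2 * P ^ (N + 1))"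
      unfolding dC dP by (simp add: f_def N_def algebra_simps power2_eq_square)
    also have "of_nat N * (C ^ 2 * P ^ (N + 1)) =
        of_nat N * (P ^ (N + 1) - (fps_X ^ 2) * ((H * P) ^ 2 * P ^ (N - 1)))"
      unfolding C2 by (simp add: N_def algebra_simps power2_eq_square)
    finally have eq: "fps_X * fps_deriv f - of_nat N * f =
        of_nat (N - 1) * (fps_X ^ 2 * P ^ (N - 1)) - of_nat N * P ^ (N + 1)"
      by (simp add: HP N_def algebra_simps)
    \<comment> \<open>The coefficient of x^N in x f' is N times that of f. This is the vanishing
      residue; it links the exponents \<open>N + 1\<close> and \<open>N - 1\<close>.\<close>
    have "fps_nth (fps_X * fps_deriv f - of_nat N * f) N = 0"
      by (simp add: N_def flip: fps_of_nat)
    then have "real N * fps_nth (P ^ (N + 1)) N = real (N - 1) * fps_nth (P ^ (N - 1)) (N - 2)"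
      unfolding eq by (simp add: N_def fps_X_power_mult_nth flip: fps_of_nat)
    moreover have "N - 2 = 2 * m" "N - 1 = 2 * m + 1" "N + 1 = 2 * Suc m + 1" "N = 2 * Suc m"
      by (simp_all add: N_def)
    ultimately have rec: "real (2 * Suc m) * fps_nth (P ^ (2 * Suc m + 1)) (2 * Suc m) =
        real (2 * m + 1) * fps_nth (P ^ (2 * m + 1)) (2 * m)"
      by metis
    define a where "a = fps_nth (P ^ (2 * Suc m + 1)) (2 * Suc m)"
    have "a = real (2 * m + 1) * (pochhammer (1 / 2) m / fact m) / real (2 * Suc m)"
      using rec unfolding a_def[symmetric] Suc.IH[folded P_def]
      by (simp add: eq_divide_eq mult_ac del: of_nat_Suc of_nat_mult of_nat_add)
    also have "\<dots> = pochhammer (1 / 2) (Suc m) / fact (Suc m)"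
      by (simp add: pochhammer_Suc field_simps)
    finally show ?case
      by (simp only: a_def P_def)
  qed
qed

section \<open>The coefficients of the formal integral\<close>

lemma fps_nth_formal_integral_sin:
  "fps_nth (formal_integral sin_action) m = 2 ^ m * pochhammer (1 / 2) m ^ 2 / fact m"
proof -
  obtain V where S: "sin_action = - (fps_const (1 / (2 * 1)) * fps_X ^ 2) + V"
    and V3: "fps_X ^ 3 dvd V"
    by (rule sin_action_admissible)
  define H :: "real fps" where "H = fps_shift 1 (fps_sin 1)"
  have H: "fps_X * H = fps_sin 1"
    by (rule fps_ext) (auto simp: H_def)
  have H0: "fps_nth H 0 = 1"
    by (simp add: H_def)
  \<comment> \<open>Splitting off x^2 / 2 from \<open>V\<close> makes the k-th power of
    \<open>V\<close> cost exactly x^(2k), so the relevant coefficient of u^k has index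
    \<open>2 * m\<close> for every k.\<close>
  define u where "u = 1 - H ^ 2"
  have V: "V = fps_const (1 / 2) * (fps_X ^ 2 * u)"
    using S by (simp add: sin_action_def u_def algebra_simps flip: H power_mult_distrib)
  have Vk: "fps_nth (V ^ k) (2 * (m + k)) = fps_nth (u ^ k) (2 * m) / 2 ^ k" for k
    by (simp add: V power_mult_distrib fps_const_power fps_X_power_mult_nth power_one_over
        flip: power_mult)
  \<comment> \<open>\<open>s\<close> = m + 1/2 is the base of the Pochhammer symbol in
    \<open>odd_dfact_add\<close>; since 1 - u = H^2, raising it to the power \<open>- s\<close>
    gives H^(-(2m+1)).\<close>
  define s where "s = real (2 * m + 1) / 2"
  have "fps_nth (formal_integral sin_action) m =
      (\<Sum>n\<le>3 * m. fls_nth (formal_integral_term 1 V n) (int m))"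
    unfolding S formal_integral_eq[OF zero_less_one V3]
    using sums_unique[OF formal_integral_summable[OF V3, of 1], symmetric] by simp
  \<comment> \<open>The term with index n carries hbar^(n-k) with k \<ge> 0, so n < m contributes
    nothing to hbar^m. Shifting by m then makes the index the power k of \<open>V\<close>, with the
    range 0..2m on which the composition coefficient is summed.\<close>
  also have "\<dots> = (\<Sum>n=m..3 * m. fls_nth (formal_integral_term 1 V n) (int m))"
    by (rule sum.mono_neutral_right)
      (auto simp: fls_nth_formal_integral_term intro!: sum.neutral)
  also have "\<dots> = (\<Sum>k=0..2 * m. fls_nth (formal_integral_term 1 V (m + k)) (int m))"
    by (rule sum.reindex_bij_witness[of _ "\<lambda>k. m + k" "\<lambda>n. n - m"]) auto
  also have "\<dots> = (\<Sum>k=0..2 * m. real (odd_dfact m) * (pochhammer s k / fact k * fps_nth (u ^ k) (2 * m)))"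
  proof (rule sum.cong[OF refl])
    fix k
    have "(\<Sum>j\<le>2 * (m + k). if int (m + k) - int j = int m
            then fps_nth (V ^ j) (2 * (m + k)) / fact j else 0) =
          (\<Sum>j\<le>2 * (m + k). if j = k then fps_nth (V ^ k) (2 * (m + k)) / fact k else 0)"
      by (rule sum.cong) auto
    also have "\<dots> = fps_nth (V ^ k) (2 * (m + k)) / fact k"
      by (subst sum.delta) auto
    finally have "fls_nth (formal_integral_term 1 V (m + k)) (int m) =
        real (odd_dfact (m + k)) * (fps_nth (V ^ k) (2 * (m + k)) / fact k)"
      by (simp only: fls_nth_formal_integral_term) simp
    moreover have "real m + 1 / 2 = s"
      by (simp add: s_def field_simps)
    ultimately show "fls_nth (formal_integral_term 1 V (m + k)) (int m) =
        real (odd_dfact m) * (pochhammer s k / fact k * fps_nth (u ^ k) (2 * m))"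
      by (simp only: Vk odd_dfact_add) (simp add: field_simps)
  qed
  also have "\<dots> = real (odd_dfact m) * fps_nth (fps_binomial (- s) oo (- u)) (2 * m)"
  proof -
    have sign: "fps_nth ((- u) ^ k) j = (- 1) ^ k * fps_nth (u ^ k) j" for k j
      by (cases "even k") auto
    have "(- 1) ^ k * ((- 1) ^ k * x) = x" for k and x :: real
      by (simp flip: mult.assoc power_add mult_2)
    then show ?thesis
      by (simp add: fps_compose_nth sum_distrib_left gbinomial_pochhammer sign mult_ac)
  qed
  also have "fps_binomial (- s) oo (- u) = inverse H ^ (2 * m + 1)"
    unfolding s_def by (rule fps_binomial_half_compose) (simp_all add: u_def H0)
  also have "fps_nth \<dots> (2 * m) = pochhammer (1 / 2) m / fact m"
    by (rule residue_inverse_sin_power[OF H])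
  finally show ?thesis
    by (simp add: odd_dfact_pochhammer power2_eq_square)
qed

section \<open>Gamma ratios and the leading asymptotics from Wallis' product\<close>

lemma Gamma_nat_diff_Suc:
  assumes "k < n"
  shows "Gamma (real (Suc n) - real k) = (real n - real k) * Gamma (real n - real k)"
proof -
  \<comment> \<open>At k = n the recurrence fails: the left side is Gamma 1 = 1, while the right
    side has the factor 0.\<close>
  have "real n - real k \<notin> \<int>\<^sub>\<le>\<^sub>0"
    using assms nonpos_Ints_nonpos[of "real n - real k"] by auto
  from Gamma_plus1[OF this] show ?thesis
    by (simp add: algebra_simps)
qed

lemma Gamma_nat_diff_pos: "k < n \<Longrightarrow> Gamma (real n - real k) > 0"
  by (intro Gamma_real_pos) simp

lemma Gamma_real_nonzero_of_nat: "n > 0 \<Longrightarrow> Gamma (real n) \<noteq> 0"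
  by (metis Gamma_real_pos less_irrefl of_nat_0_less_iff)

lemma Gamma_nat_diff_ratio_tendsto:
  "(\<lambda>n. Gamma (real n - real k) / Gamma (real n)) \<longlonglongrightarrow> (if k = 0 then 1 else 0)"
proof (induction k)
  case 0
  have "eventually (\<lambda>n. Gamma (real n - real 0) / Gamma (real n) = 1) sequentially"
    using eventually_gt_at_top[of 0] by eventually_elim (simp add: Gamma_real_nonzero_of_nat)
  then show ?case
    by (simp add: tendsto_eventually)
next
  case (Suc k)
  have inv: "(\<lambda>n. inverse (real n - real (Suc k))) \<longlonglongrightarrow> 0"
    by real_asymp
  have "(\<lambda>n. Gamma (real n - real k) / Gamma (real n) * inverse (real n - real (Suc k)))
      \<longlonglongrightarrow> (if k = 0 then 1 else 0) * 0"
    by (intro tendsto_mult Suc.IH inv)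
  moreover have "eventually (\<lambda>n. Gamma (real n - real k) / Gamma (real n) * inverse (real n - real (Suc k))
      = Gamma (real n - real (Suc k)) / Gamma (real n)) sequentially"
    using eventually_gt_at_top[of "Suc k"]
  proof eventually_elim
    case (elim n)
    then obtain l where l: "n = Suc l" "k < l"
      by (cases n) auto
    then show ?case
      using Gamma_nat_diff_Suc[OF l(2)] by simp
  qed
  ultimately show ?case
    using Lim_transform_eventually by fastforce
qed

lemma pochhammer_half_wallis:
  "(\<lambda>n. pi * pochhammer (1 / 2) n ^ 2 / fact n / Gamma (real n)) \<longlonglongrightarrow> 1"
proof -
  \<comment> \<open>The partial Wallis product in Pochhammer form. With n! = n Gamma(n), the
    sequence becomes pi n / (2n+1) divided by this product, whose limit is pi / 2.\<close>
  have *: "(\<Prod>k=1..n. (4 * real k ^ 2) / (4 * real k ^ 2 - 1)) =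
      fact n ^ 2 / (pochhammer (1 / 2) n ^ 2 * (2 * real n + 1))" for n
  proof (induction n)
    case (Suc n)
    have nz: "pochhammer (1 / 2 :: real) n > 0"
      by (simp add: pochhammer_pos)
    have f: "4 * real (Suc n) ^ 2 - 1 = (2 * real n + 1) * (2 * real n + 3)"
      by (simp add: power2_eq_square algebra_simps)
    have "(\<Prod>k=1..Suc n. (4 * real k ^ 2) / (4 * real k ^ 2 - 1)) =
        fact n ^ 2 / (pochhammer (1 / 2) n ^ 2 * (2 * real n + 1)) *
          (4 * real (Suc n) ^ 2 / ((2 * real n + 1) * (2 * real n + 3)))"
      using Suc.IH f by simp
    also have "\<dots> = (real (Suc n) * fact n) ^ 2 /
        ((pochhammer (1 / 2) n * (1 / 2 + real n)) ^ 2 * (2 * real (Suc n) + 1))"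
    proof -
      have e: "1 / 2 + real n = (2 * real n + 1) / 2" "2 * real (Suc n) + 1 = 2 * real n + 3"
        by (simp_all add: field_simps)
      have "2 * real n + 1 \<noteq> 0" "2 * real n + 3 \<noteq> 0"
        by linarith+
      then show ?thesis
        unfolding e using nz by (simp add: divide_simps power2_eq_square)
    qed
    finally show ?case
      by (simp add: pochhammer_Suc mult_ac)
  qed simp
  have "(\<lambda>n. real n / (2 * real n + 1)) \<longlonglongrightarrow> 1 / 2"
    by real_asymp
  then have "(\<lambda>n. pi * (real n / (2 * real n + 1)) /
      (\<Prod>k=1..n. (4 * real k ^ 2) / (4 * real k ^ 2 - 1))) \<longlonglongrightarrow> pi * (1 / 2) / (pi / 2)"
    by (rule tendsto_divide[OF tendsto_mult[OF tendsto_const] wallis]) simp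
  moreover have "eventually (\<lambda>n. pi * (real n / (2 * real n + 1)) /
      (\<Prod>k=1..n. (4 * real k ^ 2) / (4 * real k ^ 2 - 1)) =
      pi * pochhammer (1 / 2) n ^ 2 / fact n / Gamma (real n)) sequentially"
    using eventually_gt_at_top[of 0]
  proof eventually_elim
    case (elim n)
    then obtain l where l: "n = Suc l"
      by (cases n) auto
    have "Gamma (real n) = fact l"
      using Gamma_fact[of l] by (simp add: l add.commute)
    moreover have "2 * real n + 1 \<noteq> 0"
      by linarith
    ultimately show ?case
      unfolding * by (simp add: l divide_simps power2_eq_square)
  qed
  ultimately show ?thesis
    by (simp add: tendsto_cong)
qed

section \<open>Recurrence of the partial sums and the remainder estimate\<close>

text \<open>Sum the increments from n to infinity: the bounds telescope, and both limits are 0. This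
  converts a bound on increments into a rate of convergence.\<close>

lemma abs_le_of_increments_le:
  fixes e t :: "nat \<Rightarrow> real"
  assumes "e \<longlonglongrightarrow> 0" and "t \<longlonglongrightarrow> 0"
    and step: "\<And>n. n \<ge> N \<Longrightarrow> \<bar>e (Suc n) - e n\<bar> \<le> C * (t n - t (Suc n))"
    and "n \<ge> N"
  shows "\<bar>e n\<bar> \<le> C * t n"
proof -
  have "\<bar>e (m + n) - e n\<bar> \<le> C * (t n - t (m + n))" for m
  proof (induction m)
    case (Suc m)
    show ?case
      using Suc.IH step[of "m + n"] \<open>n \<ge> N\<close> by (simp add: algebra_simps)
  qed simp
  moreover have "(\<lambda>m. \<bar>e (m + n) - e n\<bar>) \<longlonglongrightarrow> \<bar>0 - e n\<bar>"
    by (intro tendsto_intros LIMSEQ_ignore_initial_segment assms)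
  moreover have "(\<lambda>m. C * (t n - t (m + n))) \<longlonglongrightarrow> C * (t n - 0)"
    by (intro tendsto_intros LIMSEQ_ignore_initial_segment assms)
  ultimately show ?thesis
    using LIMSEQ_le[of "\<lambda>m. \<bar>e (m + n) - e n\<bar>" "\<bar>0 - e n\<bar>"] by auto
qed

text \<open>The hypothesis on \<open>b\<close> is the condition for the infinite formal sum to
  satisfy (n+1) y(n+1) = (n+1/2)^2 y(n); truncation leaves one boundary term.\<close>

lemma partial_sum_recurrence:
  fixes b :: "nat \<Rightarrow> real"
  assumes "\<And>k. real (Suc k) * b (Suc k) = - ((real k + 1 / 2) ^ 2 * b k)" and "R \<le> n"
  shows "real (Suc n) * (\<Sum>k<R. b k * Gamma (real (Suc n) - real k))
       - (real n + 1 / 2) ^ 2 * (\<Sum>k<R. b k * Gamma (real n - real k))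
       = real R * b R * Gamma (real (Suc n) - real R)"
  using assms(2)
proof (induction R)
  case (Suc R)
  define G where "G = Gamma (real n - real R)"
  have G: "Gamma (real (Suc n) - real R) = (real n - real R) * G"
    using Gamma_nat_diff_Suc[of R n] Suc.prems by (simp add: G_def)
  have "real (Suc n) * (\<Sum>k<Suc R. b k * Gamma (real (Suc n) - real k))
       - (real n + 1 / 2) ^ 2 * (\<Sum>k<Suc R. b k * Gamma (real n - real k))
      = real R * b R * ((real n - real R) * G) + real (Suc n) * (b R * ((real n - real R) * G))
        - (real n + 1 / 2) ^ 2 * (b R * G)"
    using Suc.IH Suc.prems unfolding sum.lessThan_Suc G G_def[symmetric] by (simp add: algebra_simps)
  \<comment> \<open>This is (n - R)(n + R + 1) - (n + 1/2)^2 = -(R + 1/2)^2: the dependence on n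
    cancels.\<close>
  also have "\<dots> = - ((real R + 1 / 2) ^ 2 * b R) * G"
    by (simp add: algebra_simps power2_eq_square)
  also have "\<dots> = real (Suc R) * b (Suc R) * G"
    by (simp only: assms(1))
  finally show ?case
    by (simp add: G_def)
qed simp

lemma pochhammer_half_asymptotics:
  "(\<lambda>n. pi * pochhammer (1 / 2) n ^ 2 / fact n
      - (\<Sum>k<R. (- 1) ^ k * pochhammer (1 / 2) k ^ 2 / fact k * Gamma (real n - real k)))
   \<in> O(\<lambda>n. Gamma (real n - real R))"
proof -
  define g :: "nat \<Rightarrow> real" where "g n = pi * pochhammer (1 / 2) n ^ 2 / fact n" for n
  define b :: "nat \<Rightarrow> real" where "b k = (- 1) ^ k * pochhammer (1 / 2) k ^ 2 / fact k" for k
  define D where "D n = (\<Sum>k<R. b k * Gamma (real n - real k))" for n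
  define e where "e n = 1 - D n / g n" for n
  \<comment> \<open>A majorant of order n^(-R) whose decrement is R Gamma(n+1-R) / ((n+1)
    Gamma(n+1)), the shape of the increments of \<open>e\<close>.\<close>
  define t where "t n = Gamma (real (Suc n) - real R) / Gamma (real (Suc n))" for n
  have gpos: "g n > 0" for n
    unfolding g_def by (intro divide_pos_pos mult_pos_pos zero_less_power pochhammer_pos) auto
  have gSuc: "real (Suc n) * g (Suc n) = (real n + 1 / 2) ^ 2 * g n" for n
  proof -
    have "g (Suc n) = (real n + 1 / 2) ^ 2 / real (Suc n) * g n"
      by (simp add: g_def pochhammer_Suc power_mult_distrib add.commute mult_ac)
    then show ?thesis
      by (simp del: of_nat_Suc)
  qed
  have lim: "(\<lambda>n. g n / Gamma (real n)) \<longlonglongrightarrow> 1"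
    unfolding g_def by (rule pochhammer_half_wallis)
  show ?thesis
  \<comment> \<open>For R = 0 the sum \<open>D\<close> is empty, so \<open>e\<close> is constantly 1
    and does not tend to 0; the claim is then just the leading asymptotics.\<close>
  proof (cases "R = 0")
    case True
    have "eventually (\<lambda>n. Gamma (real n) \<noteq> 0) sequentially"
      using eventually_gt_at_top[of 0] by eventually_elim (simp add: Gamma_real_nonzero_of_nat)
    then have "g \<in> O(\<lambda>n. Gamma (real n))"
      using bigoI_tendsto[OF lim] by simp
    then show ?thesis
      by (simp add: True g_def[abs_def])
  next
    case False
    have "(\<lambda>n. \<Sum>k<R. b k * ((Gamma (real n - real k) / Gamma (real n)) / (g n / Gamma (real n))))
        \<longlonglongrightarrow> (\<Sum>k<R. b k * ((if k = 0 then 1 else 0) / 1))"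
      by (intro tendsto_intros Gamma_nat_diff_ratio_tendsto lim) auto
    also have "(\<Sum>k<R. b k * ((if k = 0 then 1 else 0) / 1)) = (\<Sum>k<R. if k = 0 then b k else 0)"
      by (intro sum.cong) auto
    also have "\<dots> = 1"
      using False by (simp add: b_def)
    finally have "(\<lambda>n. \<Sum>k<R. b k * ((Gamma (real n - real k) / Gamma (real n)) / (g n / Gamma (real n))))
        \<longlonglongrightarrow> 1" .
    also have "?this \<longleftrightarrow> (\<lambda>n. D n / g n) \<longlonglongrightarrow> 1"
    proof (rule tendsto_cong)
      show "\<forall>\<^sub>F n in sequentially. (\<Sum>k<R. b k * ((Gamma (real n - real k) / Gamma (real n)) /
          (g n / Gamma (real n)))) = D n / g n"
        using eventually_gt_at_top[of 0]
      proof eventually_elim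
        case (elim n)
        then have "Gamma (real n) > 0"
          by (simp add: Gamma_real_pos)
        then show ?case
          by (simp add: D_def sum_divide_distrib)
      qed
    qed
    finally have "e \<longlonglongrightarrow> 1 - 1"
      unfolding e_def by (intro tendsto_intros)
    then have e0: "e \<longlonglongrightarrow> 0"
      by simp
    have t0: "t \<longlonglongrightarrow> 0"
      using LIMSEQ_Suc[OF Gamma_nat_diff_ratio_tendsto[of R]] False by (simp add: t_def[abs_def])
    \<comment> \<open>The lower bound controls the denominator in the increments of
      \<open>e\<close>; the upper bound returns from the relative error \<open>e\<close> to the
      absolute error. Together they give the constants 2 and 4 below.\<close>
    have "eventually (\<lambda>n. g n / Gamma (real n) > 1 / 2) sequentially"
      "eventually (\<lambda>n. g n / Gamma (real n) < 2) sequentially"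
      by (rule order_tendstoD[OF lim], simp)+
    then have "eventually (\<lambda>n. n > R \<and> g n / Gamma (real n) > 1 / 2 \<and> g n / Gamma (real n) < 2) sequentially"
      using eventually_gt_at_top[of R] by eventually_elim auto
    then obtain N where N: "n > R" "g n / Gamma (real n) > 1 / 2" "g n / Gamma (real n) < 2"
      if "n \<ge> N" for n
      unfolding eventually_sequentially by blast
    have bSuc: "real (Suc k) * b (Suc k) = - ((real k + 1 / 2) ^ 2 * b k)" for k
    proof -
      have "b (Suc k) = - ((real k + 1 / 2) ^ 2 / real (Suc k) * b k)"
        by (simp add: b_def pochhammer_Suc power_mult_distrib add.commute mult_ac)
      then show ?thesis
        by (simp del: of_nat_Suc)
    qed
    have step: "\<bar>e (Suc n) - e n\<bar> \<le> 2 * \<bar>b R\<bar> * (t n - t (Suc n))" if n: "n \<ge> N" for n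
    proof -
      have Rn: "R < n" "0 < n"
        using N(1)[OF n] by auto
      define x where "x = Gamma (real (Suc n) - real R)"
      have xpos: "x > 0"
        using Rn unfolding x_def by (intro Gamma_nat_diff_pos) simp
      define y where "y = Gamma (real (Suc n))"
      have ypos: "y > 0"
        unfolding y_def by (intro Gamma_real_pos) simp
      have y2: "Gamma (real (Suc (Suc n))) = real (Suc n) * y"
        using Gamma_nat_diff_Suc[of 0 "Suc n"] by (simp add: y_def)
      have x2: "Gamma (real (Suc (Suc n)) - real R) = (real (Suc n) - real R) * x"
        using Gamma_nat_diff_Suc[of R "Suc n"] Rn by (simp add: x_def)
      have g: "y \<le> 2 * g (Suc n)"
        using N(2)[of "Suc n", folded y_def] n ypos by (simp add: field_simps)
      have "e (Suc n) - e n = D n / g n - D (Suc n) / g (Suc n)"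
        by (simp add: e_def)
      \<comment> \<open>Rewriting \<open>g n\<close> through \<open>g (Suc n)\<close> gives both
        quotients a common denominator, so that the numerator becomes the defect in
        \<open>partial_sum_recurrence\<close>.\<close>
      also have "D n / g n = (real n + 1 / 2) ^ 2 * D n / (real (Suc n) * g (Suc n))"
        unfolding gSuc using gpos[of n] by (simp add: field_simps add_pos_nonneg)
      also have "\<dots> - D (Suc n) / g (Suc n) =
          - (real (Suc n) * D (Suc n) - (real n + 1 / 2) ^ 2 * D n) / (real (Suc n) * g (Suc n))"
        using gpos[of "Suc n"] by (simp add: divide_simps del: of_nat_Suc)
      also have "\<dots> = - (real R * b R * x) / (real (Suc n) * g (Suc n))"
        unfolding D_def x_def using partial_sum_recurrence[OF bSuc, of R n] Rn by simp
      finally have "\<bar>e (Suc n) - e n\<bar> = real R * \<bar>b R\<bar> * x / (real (Suc n) * g (Suc n))"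
        using xpos gpos[of "Suc n"] by (simp add: abs_mult)
      also have "\<dots> \<le> real R * \<bar>b R\<bar> * x / (real (Suc n) * (y / 2))"
        using xpos ypos g by (intro divide_left_mono mult_left_mono mult_pos_pos) auto
      also have "\<dots> = 2 * \<bar>b R\<bar> * (t n - t (Suc n))"
      proof -
        have "x / y - (r - real R) * x / (r * y) = real R * x / (r * y)" if "r > 0" for r
          using that ypos by (simp add: divide_simps) (simp add: algebra_simps)
        from this[of "real (Suc n)"] have "t n - t (Suc n) = real R * x / (real (Suc n) * y)"
          unfolding t_def y2 x2 x_def[symmetric] y_def[symmetric] by simp
        then show ?thesis
          by simp
      qed
      finally show ?thesis .
    qed
    have bound: "\<bar>g n - D n\<bar> \<le> 4 * \<bar>b R\<bar> * \<bar>Gamma (real n - real R)\<bar>" if n: "n \<ge> N" for n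
    proof -
      have Rn: "R < n" "0 < n"
        using N(1)[OF n] by auto
      define x where "x = Gamma (real n - real R)"
      have xpos: "x > 0"
        using Rn unfolding x_def by (intro Gamma_nat_diff_pos) simp
      define y where "y = Gamma (real n)"
      have ypos: "y > 0"
        unfolding y_def using Rn by (intro Gamma_real_pos) simp
      have t: "t n = (real n - real R) * x / (real n * y)"
        using Gamma_nat_diff_Suc[of R n] Gamma_nat_diff_Suc[of 0 n] Rn
        by (simp add: t_def x_def y_def)
      have "t n \<le> (real n * x) / (real n * y)"
        unfolding t using xpos ypos by (intro divide_right_mono mult_right_mono) auto
      then have t_le: "t n \<le> x / y"
        using Rn by simp
      have "\<bar>g n - D n\<bar> = g n * \<bar>e n\<bar>"
        using gpos[of n] by (simp add: e_def abs_mult_pos' field_simps)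
      also have "\<dots> \<le> (2 * y) * (2 * \<bar>b R\<bar> * (x / y))"
      proof (rule mult_mono)
        show "g n \<le> 2 * y"
          using N(3)[OF n, folded y_def] ypos by (simp add: field_simps)
        have "\<bar>e n\<bar> \<le> 2 * \<bar>b R\<bar> * t n"
          by (rule abs_le_of_increments_le[OF e0 t0 step n])
        also have "\<dots> \<le> 2 * \<bar>b R\<bar> * (x / y)"
          using t_le by (intro mult_left_mono) auto
        finally show "\<bar>e n\<bar> \<le> 2 * \<bar>b R\<bar> * (x / y)" .
      qed (use ypos in auto)
      also have "\<dots> = 4 * \<bar>b R\<bar> * \<bar>x\<bar>"
        using ypos xpos by simp
      finally show ?thesis
        by (simp add: x_def)
    qed
    have "(\<lambda>n. g n - D n) \<in> O(\<lambda>n. Gamma (real n - real R))"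
      by (rule bigoI[of _ "4 * \<bar>b R\<bar>"])
        (use bound in \<open>auto simp: eventually_sequentially\<close>)
    then show ?thesis
      by (simp add: g_def D_def b_def)
  qed
qed

theorem mainTheorem10:
  shows "Z0_QED = formal_integral sin_action \<and>
    (let c = fps_nth (fps_const (1 / pi) * (formal_integral sin_action oo (- fps_X)))
     in \<forall>R :: nat.
       (\<lambda>n :: nat. fps_nth Z0_QED n
          - (\<Sum>k<R. c k * (1 / 2 :: real) powi (- int n + int k) * Gamma (real n - real k)))
       \<in> O[at_top](\<lambda>n. (1 / 2 :: real) powi (- int n) * Gamma (real n - real R)))"
proof -
  define c where "c = fps_nth (fps_const (1 / pi) * (formal_integral sin_action oo (- fps_X)))"
  have c: "c k = (- 1) ^ k * 2 ^ k * pochhammer (1 / 2) k ^ 2 / fact k / pi" for k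
    by (simp add: c_def fps_compose_uminus' fps_nth_formal_integral_sin mult_ac)
  have pow: "(1 / 2 :: real) powi (- int n) = 2 ^ n" for n
    by (simp add: power_int_minus power_one_over)
  have pow': "(1 / 2 :: real) powi (- int n + int k) = 2 ^ n / 2 ^ k" for n k
    by (simp add: power_int_diff power_one_over)
  have "(\<lambda>n. fps_nth Z0_QED n
          - (\<Sum>k<R. c k * (1 / 2 :: real) powi (- int n + int k) * Gamma (real n - real k)))
       \<in> O[at_top](\<lambda>n. (1 / 2 :: real) powi (- int n) * Gamma (real n - real R))" for R
  proof -
    \<comment> \<open>The estimate is scaled by 2^n / pi. The factor 2^k in \<open>c k\<close>
      cancels the one in \<open>pow'\<close>, and the sign (-1)^k comes from substituting
      -hbar.\<close>
    have "(\<lambda>n. 1 / pi * (2 ^ n * (pi * pochhammer (1 / 2) n ^ 2 / fact n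
      - (\<Sum>k<R. (- 1) ^ k * pochhammer (1 / 2) k ^ 2 / fact k * Gamma (real n - real k)))))
       \<in> O(\<lambda>n. 2 ^ n * Gamma (real n - real R))"
      by (intro landau_o.big.cmult_in_iff[THEN iffD2] landau_o.big.mult
          pochhammer_half_asymptotics) auto
    also have "(\<lambda>n. 1 / pi * (2 ^ n * (pi * pochhammer (1 / 2) n ^ 2 / fact n
      - (\<Sum>k<R. (- 1) ^ k * pochhammer (1 / 2) k ^ 2 / fact k * Gamma (real n - real k))))) =
      (\<lambda>n. fps_nth Z0_QED n
          - (\<Sum>k<R. c k * (1 / 2 :: real) powi (- int n + int k) * Gamma (real n - real k)))"
      unfolding c pow' fps_nth_Z0_QED
      by (rule ext) (simp add: right_diff_distrib diff_divide_distrib sum_distrib_left sum_divide_distrib mult_ac)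
    finally show ?thesis
      by (simp only: pow)
  qed
  moreover have "Z0_QED = formal_integral sin_action"
    by (rule fps_ext) (simp add: fps_nth_Z0_QED fps_nth_formal_integral_sin)
  ultimately show ?thesis
    by (simp add: Let_def c_def)
qed

end
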